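(* Let $\Gamma$ be a signed graph containing a special path $Pv_1v_2v_3$, where $\sigma(v_1v_2)=-1$ and $\sigma(v_2v_3)=1$. Suppose that $N(v_1)\setminus\{v_2\}\neq\emptyset$ and let $v\in N(v_1)\setminus\{v_2\}$. Let $\Gamma'$ be the signed graph obtained from $\Gamma$ by deleting the edge $vv_1$ and adding a new edge $vv_3$ with the same sign as $vv_1$. Then $\eta(\Gamma')=\eta(\Gamma)$.
   Context: A signed graph $\Gamma=(G,\sigma)$ consists of a finite simple graph $G=(V,E)$ and a map $\sigma:E\to\{+,-\}$ (identified with $\{+1,-1\}$). Its adjacency matrix is the symmetric matrix $A(\Gamma)$ whose $(i,j)$ entry is $\sigma(v_iv_j)$ if $v_iv_j\in E$ and $0$ otherwise. The nullity $\eta(\Gamma)$ is the multiplicity of $0$ as an eigenvalue of $A(\Gamma)$. $N(v)$ denotes the set of neighbors of the vertex $v$ in $\Gamma$ and $d(v)=|N(v)|$. $Pv_1v_2v_3$ denotes a path on distinct vertices $v_1,v_2,v_3$ with edges $v_1v_2,v_2v_3$. Such a path contained in $\Gamma$ is called a special path of $\Gamma$ if $d(v_2)=2$, $v_1v_3\notin E(\Gamma)$, and $(N(v_1)\cap N(v_3))\setminus\{v_2\}=\emptyset$. *)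

theory Defs
  imports "Jordan_Normal_Form.Char_Poly"
begin

record 'a signed_graph =
  verts :: "'a set"
  edges :: "'a set set"
  sign :: "'a set \<Rightarrow> int"

(* The sign function is total; its values outside the edge set carry no meaning. *)
definition is_signed_graph :: "'a signed_graph \<Rightarrow> bool" where
  "is_signed_graph \<Gamma> \<longleftrightarrow>
     finite (verts \<Gamma>) \<and>
     (\<forall>e\<in>edges \<Gamma>. e \<subseteq> verts \<Gamma> \<and> card e = 2) \<and>
     (\<forall>e\<in>edges \<Gamma>. sign \<Gamma> e \<in> {1, -1})"

definition nbrs :: "'a signed_graph \<Rightarrow> 'a \<Rightarrow> 'a set" where
  "nbrs \<Gamma> v = {w \<in> verts \<Gamma>. {v, w} \<in> edges \<Gamma>}"

definition deg :: "'a signed_graph \<Rightarrow> 'a \<Rightarrow> nat" where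
  "deg \<Gamma> v = card (nbrs \<Gamma> v)"

definition adj_mat :: "'a signed_graph \<Rightarrow> 'a list \<Rightarrow> real mat" where
  "adj_mat \<Gamma> vs = mat (length vs) (length vs)
     (\<lambda>(i, j). if {vs ! i, vs ! j} \<in> edges \<Gamma> then of_int (sign \<Gamma> {vs ! i, vs ! j}) else 0)"

(* The vertices of a graph carry no canonical ordering. The multiplicity of an eigenvalue of the
   adjacency matrix does not depend on the chosen one; see nullity_eq below. *)
definition nullity :: "'a signed_graph \<Rightarrow> nat" where
  "nullity \<Gamma> =
     order 0 (char_poly (adj_mat \<Gamma> (SOME vs. distinct vs \<and> set vs = verts \<Gamma>)))"

definition is_special_path :: "'a signed_graph \<Rightarrow> 'a \<Rightarrow> 'a \<Rightarrow> 'a \<Rightarrow> bool" where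
  "is_special_path \<Gamma> v1 v2 v3 \<longleftrightarrow>
     v1 \<in> verts \<Gamma> \<and> v2 \<in> verts \<Gamma> \<and> v3 \<in> verts \<Gamma> \<and> distinct [v1, v2, v3] \<and>
     {v1, v2} \<in> edges \<Gamma> \<and> {v2, v3} \<in> edges \<Gamma> \<and>
     deg \<Gamma> v2 = 2 \<and> {v1, v3} \<notin> edges \<Gamma> \<and>
     (nbrs \<Gamma> v1 \<inter> nbrs \<Gamma> v3) - {v2} = {}"

definition delete_edge :: "'a set \<Rightarrow> 'a signed_graph \<Rightarrow> 'a signed_graph" where
  "delete_edge e \<Gamma> = \<Gamma>\<lparr>edges := edges \<Gamma> - {e}\<rparr>"

definition add_edge :: "'a set \<Rightarrow> int \<Rightarrow> 'a signed_graph \<Rightarrow> 'a signed_graph" where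
  "add_edge e s \<Gamma> = \<Gamma>\<lparr>edges := insert e (edges \<Gamma>), sign := (sign \<Gamma>)(e := s)\<rparr>"

lemma adj_mat_similar:
  assumes us: "distinct us" and vs: "distinct vs" and eq: "set us = set vs"
  shows "similar_mat (adj_mat \<Gamma> us) (adj_mat \<Gamma> vs)"
proof -
  define n where "n = length vs"
  have lu: "length us = n" using us vs eq by (metis n_def distinct_card)
  define P where "P = (\<lambda>xs ys. mat n n (\<lambda>(i, j). if xs ! i = (ys ! j :: 'a) then 1 else (0 :: real)))"
  have ex: "\<exists>k<n. xs ! i = ys ! k \<and> (\<forall>l<n. xs ! i = ys ! l \<longleftrightarrow> l = k)"
    if "i < n" "length xs = n" "length ys = n" "distinct ys" "set xs = set ys" for xs ys :: "'a list" and i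
    using that by (metis in_set_conv_nth nth_eq_iff_index_eq)
  have PM: "P xs ys * mat n n (\<lambda>(i, j). f (ys ! i) j) = mat n n (\<lambda>(i, j). f (xs ! i) j)"
    if A: "length xs = n" "length ys = n" "distinct ys" "set xs = set ys"
    for xs ys :: "'a list" and f :: "'a \<Rightarrow> nat \<Rightarrow> real"
  proof (rule eq_matI)
    fix i j assume "i < dim_row (mat n n (\<lambda>(i, j). f (xs ! i) j))"
      "j < dim_col (mat n n (\<lambda>(i, j). f (xs ! i) j))"
    then have i: "i < n" and j: "j < n" by auto
    obtain k where k: "k < n" "xs ! i = ys ! k" "\<And>l. l < n \<Longrightarrow> xs ! i = ys ! l \<longleftrightarrow> l = k"
      using ex[OF i A] by blast
    have "(P xs ys * mat n n (\<lambda>(i, j). f (ys ! i) j)) $$ (i, j)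
        = (\<Sum>l = 0..<n. (if xs ! i = ys ! l then 1 else 0) * f (ys ! l) j)"
      using i j by (simp add: P_def scalar_prod_def)
    also have "\<dots> = (\<Sum>l = 0..<n. if l = k then f (ys ! k) j else 0)"
      using k(3) by (intro sum.cong) auto
    also have "\<dots> = f (xs ! i) j" by (simp add: k(1,2))
    finally show "(P xs ys * mat n n (\<lambda>(i, j). f (ys ! i) j)) $$ (i, j)
      = mat n n (\<lambda>(i, j). f (xs ! i) j) $$ (i, j)" using i j by simp
  qed (auto simp: P_def)
  have one: "P xs ys * P ys xs = 1\<^sub>m n"
    if "length xs = n" "length ys = n" "distinct ys" "set xs = set ys" "distinct xs" for xs ys
  proof -
    have "P xs ys * P ys xs = P xs xs"
      using PM[OF that(1-4), of "\<lambda>a j. if a = xs ! j then 1 else 0"] by (simp add: P_def)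
    also have "\<dots> = 1\<^sub>m n"
      using that by (intro eq_matI) (auto simp: P_def nth_eq_iff_index_eq)
    finally show ?thesis .
  qed
  define w where "w = (\<lambda>a b. if {a, b} \<in> edges \<Gamma> then of_int (sign \<Gamma> {a, b}) else (0 :: real))"
  have adj: "adj_mat \<Gamma> xs = mat n n (\<lambda>(i, j). w (xs ! i) (xs ! j))" if "length xs = n" for xs
    using that by (simp add: adj_mat_def w_def)
  have 1: "P us vs * adj_mat \<Gamma> vs = mat n n (\<lambda>(i, j). w (us ! i) (vs ! j))"
    using PM[OF lu _ vs eq, of "\<lambda>a j. w a (vs ! j)"] by (simp add: adj n_def)
  have 2: "adj_mat \<Gamma> us * P us vs = mat n n (\<lambda>(i, j). w (us ! i) (vs ! j))"
  proof -
    have wsym: "w a b = w b a" for a b by (simp add: w_def insert_commute)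
    have tr: "adj_mat \<Gamma> us * P us vs = transpose_mat (P vs us * adj_mat \<Gamma> us)"
    proof (rule eq_matI)
      fix i j assume "i < dim_row (transpose_mat (P vs us * adj_mat \<Gamma> us))"
        "j < dim_col (transpose_mat (P vs us * adj_mat \<Gamma> us))"
      then have ij: "i < n" "j < n" using lu by (auto simp: P_def adj)
      show "(adj_mat \<Gamma> us * P us vs) $$ (i, j) = transpose_mat (P vs us * adj_mat \<Gamma> us) $$ (i, j)"
        using ij lu by (auto simp: P_def adj scalar_prod_def wsym[of "us ! i"] intro!: sum.cong)
    qed (use lu in \<open>auto simp: P_def adj\<close>)
    have "P vs us * adj_mat \<Gamma> us = mat n n (\<lambda>(i, j). w (vs ! i) (us ! j))"
      using PM[OF _ lu us eq[symmetric], of "\<lambda>a j. w a (us ! j)"] lu by (simp add: adj n_def)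
    then show ?thesis unfolding tr by (intro eq_matI) (auto simp: wsym)
  qed
  have c: "P us vs \<in> carrier_mat n n" "P vs us \<in> carrier_mat n n"
    "adj_mat \<Gamma> us \<in> carrier_mat n n" "adj_mat \<Gamma> vs \<in> carrier_mat n n"
    using lu by (auto simp: P_def adj n_def adj_mat_def)
  have "P us vs * adj_mat \<Gamma> vs * P vs us = adj_mat \<Gamma> us * (P us vs * P vs us)"
    unfolding 1 2[symmetric] using c by (simp add: assoc_mult_mat[of _ n n _ n _ n])
  also have "\<dots> = adj_mat \<Gamma> us"
    using one[OF lu _ vs eq us] c by (simp add: n_def)
  finally show ?thesis
    using c one[OF lu _ vs eq us] one[OF _ lu us eq[symmetric] vs]
    by (intro similar_matI[of _ _ "P us vs" "P vs us" n]) (auto simp: n_def)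
qed

lemma nullity_eq:
  assumes "distinct vs" "set vs = verts \<Gamma>"
  shows "nullity \<Gamma> = order 0 (char_poly (adj_mat \<Gamma> vs))"
proof -
  let ?us = "SOME us. distinct us \<and> set us = verts \<Gamma>"
  have "distinct ?us \<and> set ?us = verts \<Gamma>"
    by (rule someI[of _ vs]) (use assms in auto)
  then have "similar_mat (adj_mat \<Gamma> ?us) (adj_mat \<Gamma> vs)"
    using assms by (intro adj_mat_similar) auto
  from char_poly_similar[OF this] show ?thesis
    unfolding nullity_def by simp
qed

end

theory Submission
  imports Defs "Jordan_Normal_Form.Jordan_Normal_Form_Uniqueness"
    "Jordan_Normal_Form.Jordan_Normal_Form_Existence"
begin

text \<open>
  Every kernel vector \<open>x\<close> of the adjacency matrix satisfies \<open>x\<^sub>1 = x\<^sub>3\<close>, by the row of \<open>v2\<close>.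
  Hence moving the edge \<open>v v1\<close> of sign \<open>a\<close> to \<open>v v3\<close> leaves the row of \<open>v\<close> unaffected, and is
  compensated in the rows of \<open>v1\<close> and \<open>v3\<close> by the substitution \<open>x\<^sub>2 \<mapsto> x\<^sub>2 + a x\<^sub>v\<close>. In terms of
  matrices, the two adjacency matrices are congruent via a transvection. Congruence preserves the
  dimension of the kernel, and for a real symmetric matrix this is the algebraic multiplicity of
  the eigenvalue \<open>0\<close>, because all Jordan blocks have size one.
\<close>

text \<open>The order of the root 0 is the total size of the Jordan blocks for 0, while the
  dimension of the kernel of the k-th power is the sum of \<open>min k n\<close> over their sizes
  \<open>n\<close>. Equal kernels for k = 1 and k = 2 leave only blocks of size one. Complex entries
  guarantee that a Jordan form exists.\<close>

lemma order_0_char_poly_eq_kernel_dim: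
  fixes A :: "complex mat"
  assumes A: "A \<in> carrier_mat n n" and ker: "mat_kernel (A * A) = mat_kernel A"
  shows "Polynomial.order 0 (char_poly A) = kernel.dim n A"
proof -
  obtain as where "char_poly A = (\<Prod>a\<leftarrow>as. [:- a, 1:])"
    using char_poly_factorized[OF A] by auto
  then obtain n_as where jnf: "jordan_nf A n_as"
    using jordan_nf_exists[OF A] by blast
  define ns where "ns = map fst [(n, e)\<leftarrow>n_as. e = 0]"
  have dim: "dim_gen_eigenspace A 0 k = (\<Sum>n\<leftarrow>ns. min k n)" for k
    unfolding ns_def by (rule dim_gen_eigenspace[OF jnf])
  have char: "char_matrix A 0 = A"
    using A by (intro eq_matI) (auto simp: char_matrix_def)
  have 1: "dim_gen_eigenspace A 0 1 = kernel.dim n A"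
    using A by (simp add: dim_gen_eigenspace_def kernel_dim_def char)
  have 2: "dim_gen_eigenspace A 0 2 = kernel.dim n A"
    using A ker by (simp add: dim_gen_eigenspace_def kernel_dim_def char numeral_2_eq_2)
  \<comment> \<open>Since \<open>min 1 n \<le> min 2 n\<close> holds termwise, equal sums force
    equality in every term, so no block size exceeds 1.\<close>
  have "(\<Sum>n\<leftarrow>ms. min 2 n) = (\<Sum>n\<leftarrow>ms. min 1 n) \<Longrightarrow> sum_list ms = (\<Sum>n\<leftarrow>ms. min 1 n)"
    for ms :: "nat list"
  proof (induction ms)
    case (Cons m ms)
    have "(\<Sum>n\<leftarrow>ms. min 1 n) \<le> (\<Sum>n\<leftarrow>ms. min 2 n)"
      by (rule sum_list_mono) auto
    with Cons show ?case by (auto simp: min_def split: if_splits)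
  qed simp
  then have "sum_list ns = kernel.dim n A"
    using 1 2 dim by metis
  moreover have "Polynomial.order 0 (char_poly A) = sum_list ns"
    by (simp add: jordan_nf_order[OF jnf] ns_def case_prod_unfold)
  ultimately show ?thesis by simp
qed

text \<open>If C C x = 0, moving one factor C across the Hermitian product shows that C x has norm
  0.\<close>

lemma mat_kernel_square_real_symmetric:
  fixes A :: "real mat"
  assumes A: "A \<in> carrier_mat n n" and sym: "transpose_mat A = A"
  defines "C \<equiv> map_mat complex_of_real A"
  shows "mat_kernel (C * C) = mat_kernel C"
proof -
  have C: "C \<in> carrier_mat n n" using A by (simp add: C_def)
  have symC: "transpose_mat C = C"
    using sym by (metis C_def map_mat_transpose)
  have CC: "C * C \<in> carrier_mat n n" using C by simp
  have "x \<in> mat_kernel C" if "x \<in> mat_kernel (C * C)" for x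
  proof -
    have x: "x \<in> carrier_vec n" and 0: "C *\<^sub>v (C *\<^sub>v x) = 0\<^sub>v n"
      using mat_kernelD[OF CC that] C by auto
    have Cx: "C *\<^sub>v x \<in> carrier_vec n" using C x by simp
    \<comment> \<open>The entries of \<open>C\<close> are real, so conjugation only affects
      \<open>x\<close>.\<close>
    have conj: "conjugate (C *\<^sub>v x) = C *\<^sub>v conjugate x"
      using A x by (intro eq_vecI) (auto simp: C_def scalar_prod_def)
    have "(C *\<^sub>v x) \<bullet>c (C *\<^sub>v x) = (transpose_mat C *\<^sub>v (C *\<^sub>v x)) \<bullet> conjugate x"
      unfolding conj using C x Cx by (intro transpose_vec_mult_scalar[symmetric]) auto
    also have "\<dots> = 0"
      using x by (simp add: symC 0)
    finally have "C *\<^sub>v x = 0\<^sub>v n" using Cx by simp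
    with C x show ?thesis by (intro mat_kernelI)
  qed
  then show ?thesis
    using mat_kernel_mult_subset[OF C C] by blast
qed

text \<open>The embedding of the reals into the complex numbers preserves root multiplicities, so
  the complex Jordan form decides the real case.\<close>

lemma order_0_char_poly_real_symmetric:
  fixes A :: "real mat"
  assumes A: "A \<in> carrier_mat n n" and sym: "transpose_mat A = A"
  shows "Polynomial.order 0 (char_poly A) = kernel.dim n (map_mat complex_of_real A)"
proof -
  interpret h: map_poly_inj_idom_divide_hom complex_of_real ..
  have "Polynomial.order 0 (char_poly A) = Polynomial.order 0 (char_poly (map_mat complex_of_real A))"
    using h.order_hom[of 0 "char_poly A"] by (simp add: of_real_hom.char_poly_hom[OF A])
  also have "\<dots> = kernel.dim n (map_mat complex_of_real A)"
    using A mat_kernel_square_real_symmetric[OF A sym]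
    by (intro order_0_char_poly_eq_kernel_dim) auto
  finally show ?thesis .
qed

text \<open>An invertible factor on the left keeps the kernel itself; one on the right replaces it
  by an isomorphic preimage.\<close>

lemma kernel_dim_equivalent:
  fixes A P Q :: "'a :: field mat"
  assumes A: "A \<in> carrier_mat n n"
    and P: "P \<in> carrier_mat n n" "P' \<in> carrier_mat n n" "P * P' = 1\<^sub>m n"
    and Q: "Q \<in> carrier_mat n n" "Q' \<in> carrier_mat n n" "Q' * Q = 1\<^sub>m n"
  shows "kernel.dim n (Q * (A * P)) = kernel.dim n A"
  using mat_kernel_mult_eq[of "A * P" n n Q Q'] mat_kernel_dim_mult_eq_right[OF A P] A P(1) Q
  by simp

text \<open>With Q the transvection adding \<open>a\<close> times row \<open>l\<close> to row
  \<open>k\<close>, symmetry of \<open>A\<close> gives B = Q A Q^T: the transposition between the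
  two row operations turns the first one into a column operation. Negating \<open>a\<close> inverts
  Q, because \<open>k \<noteq> l\<close>.\<close>

lemma order_0_char_poly_transvection:
  fixes A B :: "real mat"
  assumes A: "A \<in> carrier_mat n n" and symA: "transpose_mat A = A"
    and symB: "transpose_mat B = B"
    and kl: "k < n" "l < n" "k \<noteq> l"
    and B: "B = addrow a k l (transpose_mat (addrow a k l A))"
  shows "Polynomial.order 0 (char_poly B) = Polynomial.order 0 (char_poly A)"
proof -
  let ?h = "map_mat complex_of_real"
  let ?Q = "\<lambda>a. addrow_mat n a k l"
  have QQ: "?Q (- a) * ?Q a = 1\<^sub>m n" "?Q a * ?Q (- a) = 1\<^sub>m n"
    using addrow_mat_inv[OF kl, of "- a"] addrow_mat_inv[OF kl, of a] by auto
  have inv: "?h (?Q (- a)) * ?h (?Q a) = 1\<^sub>m n"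
    using of_real_hom.mat_hom_mult[of "?Q (- a)" n n "?Q a" n] QQ
    by (metis addrow_mat_carrier of_real_hom.mat_hom_one)
  have tinv: "?h (transpose_mat (?Q a)) * ?h (transpose_mat (?Q (- a))) = 1\<^sub>m n"
    using of_real_hom.mat_hom_mult[of "transpose_mat (?Q a)" n n "transpose_mat (?Q (- a))" n]
      transpose_mult[of "?Q (- a)" n n "?Q a" n] QQ
    by (metis addrow_mat_carrier of_real_hom.mat_hom_one transpose_carrier_mat transpose_one)
  have eq: "B = ?Q a * (A * transpose_mat (?Q a))"
    unfolding B using A kl by (simp add: addrow_mat[of _ n n] transpose_mult[of _ n n _ n] symA)
  have Bc: "B \<in> carrier_mat n n"
    unfolding B using A by simp
  have "?h B = ?h (?Q a) * (?h A * ?h (transpose_mat (?Q a)))"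
    unfolding eq using A
    by (simp add: of_real_hom.mat_hom_mult[of _ n n _ n])
  then have "kernel.dim n (?h B) = kernel.dim n (?h A)"
    using kernel_dim_equivalent[OF _ _ _ tinv _ _ inv, of "?h A"] A by simp
  then show ?thesis
    using order_0_char_poly_real_symmetric A Bc symA symB by metis
qed

lemma adj_mat_carrier: "adj_mat \<Gamma> vs \<in> carrier_mat (length vs) (length vs)"
  by (simp add: adj_mat_def)

lemma transpose_adj_mat: "transpose_mat (adj_mat \<Gamma> vs) = adj_mat \<Gamma> vs"
  by (intro eq_matI) (auto simp: adj_mat_def insert_commute)

theorem lemma2p7:
  fixes \<Gamma> \<Gamma>' :: "'a signed_graph" and v v1 v2 v3 :: 'a
  assumes "is_signed_graph \<Gamma>"
    and "is_special_path \<Gamma> v1 v2 v3"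
    and "sign \<Gamma> {v1, v2} = -1" and "sign \<Gamma> {v2, v3} = 1"
    and "nbrs \<Gamma> v1 - {v2} \<noteq> {}" and "v \<in> nbrs \<Gamma> v1 - {v2}"
    and "\<Gamma>' = add_edge {v, v3} (sign \<Gamma> {v, v1}) (delete_edge {v, v1} \<Gamma>)"
  shows "nullity \<Gamma>' = nullity \<Gamma>"
proof -
  have fin: "finite (verts \<Gamma>)"
    using assms(1) by (simp add: is_signed_graph_def)
  note sp = assms(2)[unfolded is_special_path_def]
  obtain vs where vs: "set vs = verts \<Gamma>" "distinct vs"
    using finite_distinct_list[OF fin] by blast
  \<comment> \<open>The vertex set is unchanged, so one enumeration serves both nullities.\<close>
  have vs': "set vs = verts \<Gamma>'"
    using vs assms(7) by (simp add: add_edge_def delete_edge_def)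
  have noloop: "{x} \<notin> edges \<Gamma>" for x
  proof
    assume "{x} \<in> edges \<Gamma>"
    then have "card {x} = 2" using assms(1) unfolding is_signed_graph_def by blast
    then show False by simp
  qed
  have vv1: "{v1, v} \<in> edges \<Gamma>" and v: "v \<in> verts \<Gamma>" "v \<noteq> v2"
    using assms(6) by (auto simp: nbrs_def)
  have ne: "v \<noteq> v1" "v \<noteq> v3" "v1 \<noteq> v2" "v2 \<noteq> v3" "v1 \<noteq> v3"
    using noloop[of v1] vv1 sp by auto
  \<comment> \<open>Otherwise \<open>v\<close> would be a common neighbor of \<open>v1\<close> and
    \<open>v3\<close> other than \<open>v2\<close>. Hence the added edge is really new.\<close>
  have vv3: "{v3, v} \<notin> edges \<Gamma>"
    using assms(6) sp v by (auto simp: nbrs_def)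
  have "nbrs \<Gamma> v2 = {v1, v3}"
  proof (rule sym, rule card_subset_eq)
    show "finite (nbrs \<Gamma> v2)" using fin by (simp add: nbrs_def)
    show "{v1, v3} \<subseteq> nbrs \<Gamma> v2" using sp by (auto simp: nbrs_def insert_commute)
    show "card {v1, v3} = card (nbrs \<Gamma> v2)" using sp ne by (simp add: deg_def)
  qed
  then have nb2: "{v2, x} \<in> edges \<Gamma> \<longleftrightarrow> x = v1 \<or> x = v3" if "x \<in> verts \<Gamma>" for x
  proof -
    have "x \<in> nbrs \<Gamma> v2 \<longleftrightarrow> x = v1 \<or> x = v3" using \<open>nbrs \<Gamma> v2 = _\<close> by blast
    with that show ?thesis by (simp add: nbrs_def)
  qed
  define w where "w = (\<lambda>(\<Delta> :: 'a signed_graph) x y.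
    if {x, y} \<in> edges \<Delta> then real_of_int (sign \<Delta> {x, y}) else 0)"
  have w_sym: "w \<Delta> x y = w \<Delta> y x" for \<Delta> x y
    by (simp add: w_def insert_commute)
  define a where "a = w \<Gamma> v v1"
  \<comment> \<open>The opposite signs on the path enter here. Adding \<open>a\<close> times this
    row to the row of \<open>v\<close> turns the entry \<open>a\<close> at \<open>v1\<close> into 0
    and the entry 0 at \<open>v3\<close> into \<open>a\<close>, which is exactly the move of the
    edge.\<close>
  have w2: "w \<Gamma> v2 x = (if x = v3 then 1 else if x = v1 then -1 else 0)" if "x \<in> verts \<Gamma>" for x
    using nb2[OF that] ne assms(3,4) by (auto simp: w_def insert_commute)
  have w': "w \<Gamma>' x y = (if {x, y} = {v, v3} then a else if {x, y} = {v, v1} then 0 else w \<Gamma> x y)"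
    for x y
    using assms(7) vv1 ne
    by (auto simp: w_def a_def add_edge_def delete_edge_def insert_commute doubleton_eq_iff)
  have wv3: "w \<Gamma> v v3 = 0" "w \<Gamma> v v1 = a"
    using vv3 by (auto simp: w_def a_def insert_commute)
  \<comment> \<open>The right-hand side is the entry produced by the row and column operations. At
    (\<open>v\<close>, \<open>v\<close>) the corrections vanish, since \<open>v2\<close> is adjacent
    neither to itself nor to \<open>v\<close>.\<close>
  have key: "w \<Gamma>' x y =
      (if x = v then a * (if y = v then a * w \<Gamma> v2 v2 + w \<Gamma> v v2 else w \<Gamma> y v2) else 0)
      + (if y = v then a * w \<Gamma> v2 x else 0) + w \<Gamma> x y"
    if "x \<in> verts \<Gamma>" "y \<in> verts \<Gamma>" for x y
  proof -
    have col2: "w \<Gamma> z v2 = (if z = v3 then 1 else if z = v1 then -1 else 0)" if "z \<in> verts \<Gamma>" for z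
      using w2[OF that] by (simp add: w_sym)
    have v2: "v2 \<in> verts \<Gamma>" using sp by blast
    have wv': "w \<Gamma> v3 v = 0" "w \<Gamma> v1 v = a"
      using wv3 by (simp_all add: w_sym)
    show ?thesis
      unfolding w' w2[OF that(1)] w2[OF v2] col2[OF that(2)] col2[OF v(1)] doubleton_eq_iff
      using ne v wv3 wv' by (cases "x = v"; cases "y = v") auto
  qed
  have adj: "adj_mat \<Delta> vs = mat (length vs) (length vs) (\<lambda>(i, j). w \<Delta> (vs ! i) (vs ! j))" for \<Delta>
    by (simp add: adj_mat_def w_def)
  \<comment> \<open>The transvection adds a multiple of the row of \<open>v2\<close>, at position
    \<open>l\<close>, to the row of \<open>v\<close>, at position \<open>k\<close>.\<close>
  obtain k l where kl: "k < length vs" "vs ! k = v" "l < length vs" "vs ! l = v2"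
    using v sp vs(1) by (metis in_set_conv_nth)
  have nth: "vs ! i \<in> verts \<Gamma>" "vs ! i = v \<longleftrightarrow> i = k" if "i < length vs" for i
    using that vs kl nth_eq_iff_index_eq[of vs i k] by (auto simp flip: vs(1))
  have "Polynomial.order 0 (char_poly (adj_mat \<Gamma>' vs)) = Polynomial.order 0 (char_poly (adj_mat \<Gamma> vs))"
  proof (rule order_0_char_poly_transvection[OF adj_mat_carrier transpose_adj_mat transpose_adj_mat])
    show "adj_mat \<Gamma>' vs = addrow a k l (transpose_mat (addrow a k l (adj_mat \<Gamma> vs)))"
    proof (rule eq_matI)
      fix i j
      assume "i < dim_row (addrow a k l (transpose_mat (addrow a k l (adj_mat \<Gamma> vs))))"
        and "j < dim_col (addrow a k l (transpose_mat (addrow a k l (adj_mat \<Gamma> vs))))"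
      then have ij: "i < length vs" "j < length vs" by (auto simp: adj)
      show "adj_mat \<Gamma>' vs $$ (i, j)
        = addrow a k l (transpose_mat (addrow a k l (adj_mat \<Gamma> vs))) $$ (i, j)"
        using ij kl key[OF nth(1)[OF ij(1)] nth(1)[OF ij(2)]] nth(2)[OF ij(1)] nth(2)[OF ij(2)]
        by (auto simp: adj w_sym algebra_simps)
    qed (auto simp: adj)
  qed (use kl v in auto)
  then show ?thesis
    using nullity_eq[OF vs(2)] vs(1) vs' by metis
qed

end
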